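(* Let $N\ge 1$ be an integer, let $\beta\ge 0$, and let $\mathbf a=(a_1,\dots,a_N)$ and $\mathbf b=(b_1,\dots,b_N)$ have positive entries. For $0\le t\le 1$ let $\Omega(t)=\Omega((1-t)\mathbf a+t\mathbf b)=(1-t)\Omega(\mathbf a)+t\,\Omega(\mathbf b)$ be the Minkowski combination of the boxes $\Omega(\mathbf a)$ and $\Omega(\mathbf b)$. Then $t\mapsto\lambda_1(\Omega(t))^{-1/2}$ is a concave function of $t$; that is, $$\frac{1}{\sqrt{\lambda_1(\Omega(t))}}\ \ge\ \frac{1-t}{\sqrt{\lambda_1(\Omega(0))}}+\frac{t}{\sqrt{\lambda_1(\Omega(1))}}\qquad\text{for } 0\le t\le 1.$$
   Context: For $\mathbf a=(a_1,\dots,a_N)$ with all $a_j>0$, the box is $\Omega(\mathbf a)=(-a_1,a_1)\times\cdots\times(-a_N,a_N)\subset\mathbb{R}^N$. For given $\beta\ge 0$, $\lambda_1(\Omega)$ denotes the fundamental (smallest) Robin eigenvalue of the Laplacian, i.e. the smallest $\lambda$ for which there is a function $u$, not identically zero, with $\Delta u+\lambda u=0$ in $\Omega$ and $\beta\,\partial u/\partial n+u=0$ on $\partial\Omega$ ($n$ the outward normal). For boxes it is given by the explicit formula $\lambda_1(\Omega(\mathbf a))=\sum_{j=1}^N\mu(a_j)^2$, where, if $\beta>0$, $\mu(c)$ is the unique solution in $(0,\pi/(2c))$ of $\mu\tan(c\mu)=1/\beta$, and, if $\beta=0$, $\mu(c)=\pi/(2c)$. *)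

theory Defs
  imports "HOL-Analysis.Analysis"
begin

definition partial_deriv :: "'n::finite \<Rightarrow> (real^'n \<Rightarrow> real) \<Rightarrow> real^'n \<Rightarrow> real" where
  "partial_deriv i u x = frechet_derivative u (at x) (axis i 1)"

definition laplacian :: "(real^'n::finite \<Rightarrow> real) \<Rightarrow> real^'n \<Rightarrow> real" where
  "laplacian u x = (\<Sum>i\<in>UNIV. partial_deriv i (partial_deriv i u) x)"

text \<open>The next two predicates are meant for open sets.\<close>

definition C1_on :: "(real^'n::finite) set \<Rightarrow> (real^'n \<Rightarrow> real) \<Rightarrow> bool" where
  "C1_on S u \<longleftrightarrow>
     (\<forall>x\<in>S. u differentiable (at x)) \<and> (\<forall>i. continuous_on S (partial_deriv i u))"

definition C2_on :: "(real^'n::finite) set \<Rightarrow> (real^'n \<Rightarrow> real) \<Rightarrow> bool" where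
  "C2_on S u \<longleftrightarrow> C1_on S u \<and> (\<forall>i. C1_on S (partial_deriv i u))"

text \<open>
  \<open>u\<close> is continuously differentiable up to the boundary of \<open>S\<close>, with gradient \<open>g\<close>.
  At boundary points the derivative is one-sided, i.e. taken within the closure.
\<close>

definition C1_closure_grad ::
    "(real^'n::finite) set \<Rightarrow> (real^'n \<Rightarrow> real) \<Rightarrow> (real^'n \<Rightarrow> real^'n) \<Rightarrow> bool" where
  "C1_closure_grad S u g \<longleftrightarrow>
     continuous_on (closure S) g \<and>
     (\<forall>x\<in>closure S. (u has_derivative (\<lambda>h. g x \<bullet> h)) (at x within closure S))"

text \<open>
  \<open>\<nu>\<close> is the outward unit normal of \<open>S\<close> at the boundary point \<open>x\<close>: near \<open>x\<close>, and outside
  arbitrarily thin double cones around the hyperplane orthogonal to \<open>\<nu>\<close>, the set \<open>S\<close> agrees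
  with the half-space \<open>(y - x) \<bullet> \<nu> < 0\<close>. For a box there is a normal exactly at the points
  of the relative interiors of the faces, namely \<open>\<plusminus>\<close> the corresponding unit coordinate
  vector; where several faces meet there is none.
\<close>

definition outward_normal :: "(real^'n::finite) set \<Rightarrow> real^'n \<Rightarrow> real^'n \<Rightarrow> bool" where
  "outward_normal S x \<nu> \<longleftrightarrow>
     x \<in> frontier S \<and> norm \<nu> = 1 \<and>
     (\<forall>e>0. \<exists>d>0. \<forall>y\<in>ball x d.
        ((y - x) \<bullet> \<nu> < - e * norm (y - x) \<longrightarrow> y \<in> S) \<and>
        ((y - x) \<bullet> \<nu> > e * norm (y - x) \<longrightarrow> y \<notin> S))"

text \<open>
  Classical solutions, of class \<open>C\<^sup>2\<close> inside and \<open>C\<^sup>1\<close> up to the boundary. The boundary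
  condition is required wherever there is an outward normal.
\<close>

definition robin_eigenfunction ::
    "real \<Rightarrow> (real^'n::finite) set \<Rightarrow> real \<Rightarrow> (real^'n \<Rightarrow> real) \<Rightarrow> bool" where
  "robin_eigenfunction \<beta> \<Omega> l u \<longleftrightarrow>
     (\<exists>x\<in>\<Omega>. u x \<noteq> 0) \<and>
     C2_on \<Omega> u \<and>
     (\<forall>x\<in>\<Omega>. laplacian u x + l * u x = 0) \<and>
     (\<exists>g. C1_closure_grad \<Omega> u g \<and>
        (\<forall>x \<nu>. outward_normal \<Omega> x \<nu> \<longrightarrow> \<beta> * (g x \<bullet> \<nu>) + u x = 0))"

definition robin_eigenvalue :: "real \<Rightarrow> (real^'n::finite) set \<Rightarrow> real \<Rightarrow> bool" where
  "robin_eigenvalue \<beta> \<Omega> l \<longleftrightarrow> (\<exists>u. robin_eigenfunction \<beta> \<Omega> l u)"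

definition robin_lambda1 :: "real \<Rightarrow> (real^'n::finite) set \<Rightarrow> real" where
  "robin_lambda1 \<beta> \<Omega> = (LEAST l. robin_eigenvalue \<beta> \<Omega> l)"

definition centred_box :: "real^'n::finite \<Rightarrow> (real^'n) set" where
  "centred_box c = box (- c) c"

definition box_path :: "real^'n::finite \<Rightarrow> real^'n \<Rightarrow> real \<Rightarrow> (real^'n) set" where
  "box_path a b t = centred_box ((1 - t) *\<^sub>R a + t *\<^sub>R b)"

end

theory Submission
  imports Defs
begin

text \<open>
  The fundamental eigenvalue of a box separates: it is the sum of the squares of the frequencies
  \<open>\<mu>\<close> of its sides (\<open>robin_lambda1_centred_box\<close>). The product of the functions \<open>cos (\<mu> i * x $ i)\<close> is an
  eigenfunction for this value. That no eigenvalue is smaller follows from a maximum principle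
  (\<open>robin_eigenvalue_lower_bound\<close>): an arbitrary eigenfunction is compared with a product of cosines of
  slightly smaller frequencies, which is positive on the closed box and a strict supersolution for
  the Robin condition. At the point where the eigenfunction touches a multiple of
  this product from below, either the second derivatives bound the eigenvalue or the first
  derivatives contradict the boundary condition.

  Concavity then reduces to two facts about real functions. First, \<open>1 / \<mu>\<close> is a concave function of
  the half-width \<open>c\<close>, because the inverse function \<open>r \<mapsto> r * (pi / 2 - arctan (\<beta> / r))\<close> is
  convex (\<open>half_width_convex\<close>). Second, \<open>(\<Sum>i. (r i) powr (-2)) powr (-1/2)\<close> is an increasing concave
  function of positive vectors \<open>r\<close>, by the reverse Minkowski inequality
  (\<open>inverse_square_sum_superadditive\<close>). As \<open>r i = 1 / \<mu> (c $ i)\<close> turns the second function into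
  \<open>\<lambda>\<^sub>1 powr (-1/2)\<close>, the latter is concave in the vector of half-widths, which depends affinely
  on \<open>t\<close>.
\<close>

section \<open>The frequency of a side\<close>

text \<open>
  For \<open>\<beta> > 0\<close> the equation \<open>\<mu> * tan (c * \<mu>) = 1 / \<beta>\<close> on \<open>(0, pi / (2 * c))\<close> says that \<open>c * \<mu>\<close> and
  \<open>arctan (\<beta> * \<mu>)\<close> are complementary angles. This form also covers the Dirichlet case \<open>\<beta> = 0\<close>, where
  it reads \<open>\<mu> = pi / (2 * c)\<close>, and its left-hand side is strictly increasing in \<open>\<mu>\<close>.
\<close>
definition robin_freq :: "real \<Rightarrow> real \<Rightarrow> real" where
  "robin_freq \<beta> c = (THE \<mu>. \<mu> > 0 \<and> c * \<mu> + arctan (\<beta> * \<mu>) = pi / 2)"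

lemma freq_equation_strict_mono:
  fixes \<beta> c :: real
  assumes "\<beta> \<ge> 0" "c > 0" "\<mu> < \<nu>"
  shows "c * \<mu> + arctan (\<beta> * \<mu>) < c * \<nu> + arctan (\<beta> * \<nu>)"
proof -
  have "arctan (\<beta> * \<mu>) \<le> arctan (\<beta> * \<nu>)"
    using assms by (simp add: arctan_monotone' mult_left_mono)
  with assms show ?thesis by (simp add: add_less_le_mono)
qed

lemma robin_freq:
  fixes \<beta> c :: real
  assumes "\<beta> \<ge> 0" "c > 0"
  shows robin_freq_pos: "robin_freq \<beta> c > 0"
    and robin_freq_eq: "c * robin_freq \<beta> c + arctan (\<beta> * robin_freq \<beta> c) = pi / 2"
proof -
  let ?F = "\<lambda>\<mu>. c * \<mu> + arctan (\<beta> * \<mu>)"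
  have "\<exists>\<mu>. 0 \<le> \<mu> \<and> \<mu> \<le> pi / (2 * c) \<and> ?F \<mu> = pi / 2"
  proof (rule IVT')
    show "?F 0 \<le> pi / 2" by simp
    show "pi / 2 \<le> ?F (pi / (2 * c))"
      using assms by simp
    show "continuous_on {0..pi / (2 * c)} ?F"
      by (intro continuous_intros)
  qed (use assms in simp)
  then obtain \<mu> where "0 \<le> \<mu>" and eq: "?F \<mu> = pi / 2" by blast
  moreover have "\<mu> \<noteq> 0" using eq by auto
  ultimately have "\<mu> > 0 \<and> ?F \<mu> = pi / 2" by simp
  moreover have "\<nu> = \<mu>" if "\<nu> > 0 \<and> ?F \<nu> = pi / 2" for \<nu>
    using freq_equation_strict_mono[OF assms] eq that by (metis less_irrefl linorder_neqE_linordered_idom)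
  ultimately have "robin_freq \<beta> c > 0 \<and> ?F (robin_freq \<beta> c) = pi / 2"
    unfolding robin_freq_def by (rule theI)
  then show "robin_freq \<beta> c > 0" and "?F (robin_freq \<beta> c) = pi / 2" by auto
qed

lemma robin_freq_le:
  fixes \<beta> c :: real
  assumes "\<beta> \<ge> 0" "c > 0" "c * m + arctan (\<beta> * m) \<ge> pi / 2"
  shows "robin_freq \<beta> c \<le> m"
  using freq_equation_strict_mono[OF assms(1,2), of m "robin_freq \<beta> c"]
    robin_freq_eq[OF assms(1,2)] assms(3) by fastforce

text \<open>
  This is the Robin condition at the end point \<open>c\<close> for the function \<open>cos (\<mu> * s)\<close>.
\<close>
lemma robin_freq_boundary:
  fixes \<beta> c :: real
  assumes "\<beta> \<ge> 0" "c > 0"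
  shows "\<beta> * robin_freq \<beta> c * sin (robin_freq \<beta> c * c) = cos (robin_freq \<beta> c * c)"
proof -
  let ?\<mu> = "robin_freq \<beta> c"
  have "?\<mu> * c = pi / 2 - arctan (\<beta> * ?\<mu>)"
    using robin_freq_eq[OF assms] by (simp add: algebra_simps)
  then have "sin (?\<mu> * c) = cos (arctan (\<beta> * ?\<mu>))" "cos (?\<mu> * c) = sin (arctan (\<beta> * ?\<mu>))"
    by (simp_all add: cos_diff sin_diff)
  moreover have "tan (arctan (\<beta> * ?\<mu>)) = \<beta> * ?\<mu>" by (rule tan_arctan)
  ultimately show ?thesis
    using cos_arctan_not_zero[of "\<beta> * ?\<mu>"] by (simp add: tan_def field_simps)
qed

text \<open>
  Below the critical frequency, \<open>cos (\<nu> * s)\<close> is a strict supersolution: \<open>\<beta> \<partial>\<^sub>n + 1\<close> applied to it is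
  positive at the end points. This strictness is what makes the comparison argument work without a
  boundary point lemma.
\<close>
lemma below_freq_boundary:
  fixes \<beta> c \<nu> :: real
  assumes "\<beta> \<ge> 0" "c > 0" "\<nu> > 0" "c * \<nu> + arctan (\<beta> * \<nu>) < pi / 2"
  shows "\<beta> * \<nu> * sin (\<nu> * c) < cos (\<nu> * c)"
proof -
  let ?\<theta> = "pi / 2 - \<nu> * c"
  have "0 \<le> arctan (\<beta> * \<nu>)" using assms by simp
  then have "c * \<nu> < pi / 2" using assms(4) by linarith
  then have \<theta>: "arctan (\<beta> * \<nu>) < ?\<theta>" "0 < ?\<theta>" "?\<theta> < pi / 2"
    using assms by (auto simp: mult.commute[of \<nu> c])
  then have "tan (arctan (\<beta> * \<nu>)) < tan ?\<theta>"
    by (intro tan_monotone) (use arctan_lbound in auto)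
  then have "\<beta> * \<nu> < sin ?\<theta> / cos ?\<theta>" by (simp only: tan_arctan) (simp only: tan_def)
  moreover have "cos ?\<theta> > 0" using \<theta> by (intro cos_gt_zero_pi) auto
  ultimately have "\<beta> * \<nu> * cos ?\<theta> < sin ?\<theta>" by (simp add: field_simps)
  then show ?thesis by (simp add: cos_diff sin_diff)
qed

section \<open>Concavity\<close>

text \<open>
  Solving the frequency equation for the half-width gives \<open>c = r * (pi / 2 - arctan (\<beta> / r))\<close>
  with \<open>r = 1 / \<mu>\<close>. Its second derivative in \<open>r\<close> is \<open>2 * \<beta>^3 / (r\<^sup>2 + \<beta>\<^sup>2)\<^sup>2\<close>. So \<open>c\<close> is a convex
  increasing function of \<open>1 / \<mu>\<close>, and therefore \<open>1 / \<mu>\<close> is a concave function of \<open>c\<close>.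
\<close>
lemma half_width_convex:
  fixes \<beta> :: real
  assumes "\<beta> \<ge> 0"
  shows "convex_on {0<..} (\<lambda>r. r * (pi / 2 - arctan (\<beta> / r)))"
proof (rule f''_ge0_imp_convex)
  fix r :: real assume "r \<in> {0<..}"
  then have r: "r > 0" by simp
  then have pos: "r\<^sup>2 + \<beta>\<^sup>2 > 0" by (simp add: add_pos_nonneg)
  have id: "1 + (\<beta> / r)\<^sup>2 = (r\<^sup>2 + \<beta>\<^sup>2) / r\<^sup>2"
    using r by (simp add: field_simps)
  have "((\<lambda>r. arctan (\<beta> / r)) has_real_derivative
      (0 * r - \<beta> * 1) / (r * r) / (1 + (\<beta> / r)\<^sup>2)) (at r)"
    using r by (intro derivative_eq_intros DERIV_divide | simp add: divide_inverse)+
  also have "(0 * r - \<beta> * 1) / (r * r) / (1 + (\<beta> / r)\<^sup>2) = - (\<beta> / (r\<^sup>2 + \<beta>\<^sup>2))"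
    unfolding id using r pos by (simp add: power2_eq_square)
  finally have atan: "((\<lambda>r. arctan (\<beta> / r)) has_real_derivative - (\<beta> / (r\<^sup>2 + \<beta>\<^sup>2))) (at r)" .
  have "((\<lambda>r. r * (pi / 2 - arctan (\<beta> / r))) has_real_derivative
      1 * (pi / 2 - arctan (\<beta> / r)) + (0 - - (\<beta> / (r\<^sup>2 + \<beta>\<^sup>2))) * r) (at r)"
    by (intro DERIV_mult DERIV_diff DERIV_ident DERIV_const atan)
  then show "((\<lambda>r. r * (pi / 2 - arctan (\<beta> / r))) has_real_derivative
      pi / 2 - arctan (\<beta> / r) + \<beta> * r / (r\<^sup>2 + \<beta>\<^sup>2)) (at r)" by simp
  have "((\<lambda>r. \<beta> * r / (r\<^sup>2 + \<beta>\<^sup>2)) has_real_derivative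
      (\<beta> * (r\<^sup>2 + \<beta>\<^sup>2) - \<beta> * r * (2 * r)) / ((r\<^sup>2 + \<beta>\<^sup>2) * (r\<^sup>2 + \<beta>\<^sup>2))) (at r)"
  proof (rule DERIV_divide)
    show "((\<lambda>r. \<beta> * r) has_real_derivative \<beta>) (at r)"
      and "((\<lambda>r. r\<^sup>2 + \<beta>\<^sup>2) has_real_derivative 2 * r) (at r)"
      by (auto intro!: derivative_eq_intros)
    show "r\<^sup>2 + \<beta>\<^sup>2 \<noteq> 0" using pos by linarith
  qed
  then have "((\<lambda>r. pi / 2 - arctan (\<beta> / r) + \<beta> * r / (r\<^sup>2 + \<beta>\<^sup>2)) has_real_derivative
      0 - - (\<beta> / (r\<^sup>2 + \<beta>\<^sup>2)) + (\<beta> * (r\<^sup>2 + \<beta>\<^sup>2) - \<beta> * r * (2 * r)) / (r\<^sup>2 + \<beta>\<^sup>2)\<^sup>2) (at r)"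
    unfolding power2_eq_square[of "r\<^sup>2 + \<beta>\<^sup>2"]
    by (intro DERIV_add DERIV_diff DERIV_const atan)
  also have "0 - - (\<beta> / (r\<^sup>2 + \<beta>\<^sup>2)) = \<beta> * (r\<^sup>2 + \<beta>\<^sup>2) / (r\<^sup>2 + \<beta>\<^sup>2)\<^sup>2"
    unfolding power2_eq_square[of "r\<^sup>2 + \<beta>\<^sup>2"] using r by simp
  also have "\<beta> * (r\<^sup>2 + \<beta>\<^sup>2) / (r\<^sup>2 + \<beta>\<^sup>2)\<^sup>2 + (\<beta> * (r\<^sup>2 + \<beta>\<^sup>2) - \<beta> * r * (2 * r)) / (r\<^sup>2 + \<beta>\<^sup>2)\<^sup>2
      = 2 * \<beta> ^ 3 / (r\<^sup>2 + \<beta>\<^sup>2)\<^sup>2"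
    unfolding add_divide_distrib[symmetric]
    by (simp add: algebra_simps power2_eq_square power3_eq_cube)
  finally show "((\<lambda>r. pi / 2 - arctan (\<beta> / r) + \<beta> * r / (r\<^sup>2 + \<beta>\<^sup>2)) has_real_derivative
      2 * \<beta> ^ 3 / (r\<^sup>2 + \<beta>\<^sup>2)\<^sup>2) (at r)" .
  show "0 \<le> 2 * \<beta> ^ 3 / (r\<^sup>2 + \<beta>\<^sup>2)\<^sup>2" using assms by simp
qed simp

text \<open>
  Concavity of \<open>c \<mapsto> 1 / \<mu>(c)\<close>, stated as an upper bound for the frequency since that is
  the form in which it is summed over the coordinates.
\<close>
lemma robin_freq_convex_combination:
  fixes \<beta> c d t :: real
  assumes \<beta>: "\<beta> \<ge> 0" and c: "c > 0" and d: "d > 0" and t: "0 < t" "t < 1"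
  shows "robin_freq \<beta> ((1 - t) * c + t * d)
    \<le> 1 / ((1 - t) / robin_freq \<beta> c + t / robin_freq \<beta> d)"
proof -
  define C where "C = (\<lambda>r. r * (pi / 2 - arctan (\<beta> / r)))"
  have C: "C (1 / robin_freq \<beta> x) = x" if "x > 0" for x
  proof -
    have "pi / 2 - arctan (\<beta> * robin_freq \<beta> x) = x * robin_freq \<beta> x"
      using robin_freq_eq[OF \<beta> that] by simp
    then show ?thesis
      using robin_freq_pos[OF \<beta> that] by (simp add: C_def)
  qed
  define r where "r = (1 - t) * (1 / robin_freq \<beta> c) + t * (1 / robin_freq \<beta> d)"
  have r: "r > 0"
    using t robin_freq_pos[OF \<beta> c] robin_freq_pos[OF \<beta> d] unfolding r_def
    by (intro add_pos_pos mult_pos_pos) auto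
  have "C r \<le> (1 - t) * C (1 / robin_freq \<beta> c) + t * C (1 / robin_freq \<beta> d)"
    using convex_onD[OF half_width_convex[OF \<beta>], of t "1 / robin_freq \<beta> c" "1 / robin_freq \<beta> d"]
      t robin_freq_pos[OF \<beta> c] robin_freq_pos[OF \<beta> d] by (simp add: r_def C_def)
  then have "C r \<le> (1 - t) * c + t * d" using C c d by simp
  then have "pi / 2 - arctan (\<beta> * (1 / r)) \<le> ((1 - t) * c + t * d) * (1 / r)"
    using r by (simp add: C_def field_simps)
  then have "robin_freq \<beta> ((1 - t) * c + t * d) \<le> 1 / r"
    using \<beta> c d t by (intro robin_freq_le add_pos_pos mult_pos_pos) linarith+
  then show ?thesis by (simp add: r_def)
qed

text \<open>
  The reverse Minkowski inequality for the exponent \<open>-2\<close>. With \<open>P\<close> and \<open>Q\<close> the two values on the left,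
  \<open>(p i + q i) / (P + Q)\<close> is a convex combination of \<open>p i / P\<close> and \<open>q i / Q\<close>; the inverse squares of
  these quotients sum to \<open>1\<close>, so convexity of \<open>1 / x\<^sup>2\<close> gives the claim after summation.
\<close>
lemma inverse_square_sum_superadditive:
  fixes p q :: "'i \<Rightarrow> real"
  assumes I: "finite I" "I \<noteq> {}" and p: "\<And>i. i \<in> I \<Longrightarrow> p i > 0" and q: "\<And>i. i \<in> I \<Longrightarrow> q i > 0"
  shows "1 / sqrt (\<Sum>i\<in>I. 1 / (p i)\<^sup>2) + 1 / sqrt (\<Sum>i\<in>I. 1 / (q i)\<^sup>2)
    \<le> 1 / sqrt (\<Sum>i\<in>I. 1 / (p i + q i)\<^sup>2)"
proof -
  define P where "P = 1 / sqrt (\<Sum>i\<in>I. 1 / (p i)\<^sup>2)"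
  define Q where "Q = 1 / sqrt (\<Sum>i\<in>I. 1 / (q i)\<^sup>2)"
  have sp: "(\<Sum>i\<in>I. 1 / (p i)\<^sup>2) > 0" and sq: "(\<Sum>i\<in>I. 1 / (q i)\<^sup>2) > 0"
    and spq: "(\<Sum>i\<in>I. 1 / (p i + q i)\<^sup>2) > 0"
    using I p q by (auto intro!: sum_pos I divide_pos_pos zero_less_power add_pos_pos)
  have PQ: "P > 0" "Q > 0" using sp sq unfolding P_def Q_def by (simp_all only: zero_less_divide_1_iff real_sqrt_gt_0_iff)
  have normalise: "(1 / sqrt S)\<^sup>2 * S = 1" if "S > 0" for S :: real
    using that by (simp add: power_divide)
  have nP: "P\<^sup>2 * (\<Sum>i\<in>I. 1 / (p i)\<^sup>2) = 1" and nQ: "Q\<^sup>2 * (\<Sum>i\<in>I. 1 / (q i)\<^sup>2) = 1"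
    unfolding P_def Q_def using sp sq by (simp_all only: normalise)
  define s where "s = Q / (P + Q)"
  have s: "0 < s" "s < 1" "1 - s = P / (P + Q)" using PQ by (auto simp: s_def field_simps)
  have conv: "convex_on {0<..} (\<lambda>x::real. inverse (x ^ 2))"
  proof (rule convex_onI)
    fix u x y :: real assume u: "0 < u" "u < 1" and xy: "x \<in> {0<..}" "y \<in> {0<..}"
    have "inverse ((1 - u) *\<^sub>R x + u *\<^sub>R y) \<le> (1 - u) * inverse x + u * inverse y"
      using convex_onD[OF convex_on_inverse[of "{0<..}"], of u x y] u xy by auto
    moreover have "0 < (1 - u) *\<^sub>R x + u *\<^sub>R y" using u xy by (simp add: add_pos_pos)
    ultimately have "(inverse ((1 - u) *\<^sub>R x + u *\<^sub>R y))\<^sup>2 \<le> ((1 - u) * inverse x + u * inverse y)\<^sup>2"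
      by (intro power_mono) auto
    also have "\<dots> \<le> (1 - u) * (inverse x)\<^sup>2 + u * (inverse y)\<^sup>2"
      using convex_onD[OF convex_power_even[of 2], of u "inverse x" "inverse y"] u by simp
    finally show "inverse (((1 - u) *\<^sub>R x + u *\<^sub>R y)\<^sup>2)
        \<le> (1 - u) * inverse (x\<^sup>2) + u * inverse (y\<^sup>2)"
      by (simp only: power_inverse)
  qed simp
  have "1 / (p i + q i)\<^sup>2 \<le> ((1 - s) * (P\<^sup>2 * (1 / (p i)\<^sup>2)) + s * (Q\<^sup>2 * (1 / (q i)\<^sup>2))) / (P + Q)\<^sup>2"
    if i: "i \<in> I" for i
  proof -
    have "(1 - s) * (p i / P) + s * (q i / Q) = (p i + q i) / (P + Q)"
      unfolding s(3) using PQ by (simp add: s_def add_divide_distrib)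
    then have "inverse (((p i + q i) / (P + Q)) ^ 2)
        \<le> (1 - s) * inverse ((p i / P) ^ 2) + s * inverse ((q i / Q) ^ 2)"
      using convex_onD[OF conv, of s "p i / P" "q i / Q"] p[OF i] q[OF i] PQ s by simp
    then have "(P + Q)\<^sup>2 * (1 / (p i + q i)\<^sup>2) \<le> (1 - s) * (P\<^sup>2 * (1 / (p i)\<^sup>2)) + s * (Q\<^sup>2 * (1 / (q i)\<^sup>2))"
      by (simp add: power_divide)
    then show ?thesis using PQ by (simp add: field_simps)
  qed
  then have "(\<Sum>i\<in>I. 1 / (p i + q i)\<^sup>2)
      \<le> (\<Sum>i\<in>I. ((1 - s) * (P\<^sup>2 * (1 / (p i)\<^sup>2)) + s * (Q\<^sup>2 * (1 / (q i)\<^sup>2))) / (P + Q)\<^sup>2)"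
    by (rule sum_mono)
  also have "\<dots> = ((1 - s) * (P\<^sup>2 * (\<Sum>i\<in>I. 1 / (p i)\<^sup>2)) + s * (Q\<^sup>2 * (\<Sum>i\<in>I. 1 / (q i)\<^sup>2))) / (P + Q)\<^sup>2"
    by (simp add: sum_divide_distrib sum.distrib sum_distrib_left add_divide_distrib)
  also have "\<dots> = (1 / (P + Q))\<^sup>2" by (simp only: nP nQ) (simp add: power_divide)
  finally have "sqrt (\<Sum>i\<in>I. 1 / (p i + q i)\<^sup>2) \<le> 1 / (P + Q)"
    using PQ by (intro real_le_lsqrt) auto
  then have "P + Q \<le> 1 / sqrt (\<Sum>i\<in>I. 1 / (p i + q i)\<^sup>2)"
    using PQ spq by (simp add: field_simps)
  then show ?thesis by (simp add: P_def Q_def)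
qed

definition freq_sq_sum :: "real \<Rightarrow> real^'n::finite \<Rightarrow> real" where
  "freq_sq_sum \<beta> c = (\<Sum>i\<in>UNIV. (robin_freq \<beta> (c $ i))\<^sup>2)"

lemma freq_sq_sum_pos:
  assumes "\<beta> \<ge> 0" "\<And>i. c $ i > 0"
  shows "freq_sq_sum \<beta> c > 0"
  unfolding freq_sq_sum_def
  by (intro sum_pos) (use robin_freq_pos assms in \<open>auto simp: less_imp_neq[symmetric]\<close>)

text \<open>
  The function \<open>(\<Sum>i. (r i) powr (-2)) powr (-1/2)\<close> is increasing and, by homogeneity and the reverse
  Minkowski inequality, concave in \<open>r\<close>. Composed with the concave functions \<open>r i = 1 / \<mu> (c $ i)\<close> it
  remains concave.
\<close>
lemma freq_sq_sum_concave:
  fixes c d :: "real^'n::finite"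
  assumes \<beta>: "\<beta> \<ge> 0" and c: "\<And>i. c $ i > 0" and d: "\<And>i. d $ i > 0" and t: "0 < t" "t < 1"
  shows "(1 - t) / sqrt (freq_sq_sum \<beta> c) + t / sqrt (freq_sq_sum \<beta> d)
    \<le> 1 / sqrt (freq_sq_sum \<beta> ((1 - t) *\<^sub>R c + t *\<^sub>R d))"
proof -
  define p where "p i = (1 - t) / robin_freq \<beta> (c $ i)" for i
  define q where "q i = t / robin_freq \<beta> (d $ i)" for i
  have p: "p i > 0" and q: "q i > 0" for i
    using t robin_freq_pos[OF \<beta>] c d by (auto simp: p_def q_def)
  have "freq_sq_sum \<beta> ((1 - t) *\<^sub>R c + t *\<^sub>R d) \<le> (\<Sum>i\<in>UNIV. 1 / (p i + q i)\<^sup>2)"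
    unfolding freq_sq_sum_def
  proof (rule sum_mono)
    fix i
    have pos: "(1 - t) * c $ i + t * d $ i > 0"
      using t c d by (intro add_pos_pos mult_pos_pos) auto
    have "robin_freq \<beta> (((1 - t) *\<^sub>R c + t *\<^sub>R d) $ i) \<le> 1 / (p i + q i)"
      using robin_freq_convex_combination[OF \<beta> c d t] by (simp add: p_def q_def)
    then have "(robin_freq \<beta> (((1 - t) *\<^sub>R c + t *\<^sub>R d) $ i))\<^sup>2 \<le> (1 / (p i + q i))\<^sup>2"
      using robin_freq_pos[OF \<beta> pos] by (intro power_mono) auto
    then show "(robin_freq \<beta> (((1 - t) *\<^sub>R c + t *\<^sub>R d) $ i))\<^sup>2 \<le> 1 / (p i + q i)\<^sup>2"
      by (simp add: power_divide)
  qed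
  moreover have "freq_sq_sum \<beta> ((1 - t) *\<^sub>R c + t *\<^sub>R d) > 0"
    using \<beta> c d t by (intro freq_sq_sum_pos) (auto intro!: add_pos_pos)
  ultimately have "1 / sqrt (\<Sum>i\<in>UNIV. 1 / (p i + q i)\<^sup>2)
      \<le> 1 / sqrt (freq_sq_sum \<beta> ((1 - t) *\<^sub>R c + t *\<^sub>R d))"
    by (intro divide_left_mono) (auto intro: mult_pos_pos)
  moreover have "1 / sqrt (\<Sum>i\<in>UNIV. 1 / (p i)\<^sup>2) = (1 - t) / sqrt (freq_sq_sum \<beta> c)"
    using t by (simp add: p_def freq_sq_sum_def power_divide sum_divide_distrib[symmetric] real_sqrt_divide)
  moreover have "1 / sqrt (\<Sum>i\<in>UNIV. 1 / (q i)\<^sup>2) = t / sqrt (freq_sq_sum \<beta> d)"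
    using t by (simp add: q_def freq_sq_sum_def power_divide sum_divide_distrib[symmetric] real_sqrt_divide)
  ultimately show ?thesis
    using inverse_square_sum_superadditive[of UNIV p q] p q by simp
qed

section \<open>Products of functions of one coordinate\<close>

definition tensor :: "('n \<Rightarrow> real \<Rightarrow> real) \<Rightarrow> real^'n::finite \<Rightarrow> real" where
  "tensor f x = (\<Prod>j\<in>UNIV. f j (x $ j))"

text \<open>
  In this form the changed factor is separated from the others, which is how boundary values and
  normal derivatives on a face are compared: the remaining product is common to both.
\<close>
lemma tensor_update:
  "tensor (f(i := h)) x = h (x $ i) * (\<Prod>j\<in>UNIV - {i}. f j (x $ j))"
  unfolding tensor_def by (subst prod.remove[of _ i]) auto

lemma tensor_remove:
  "tensor f x = f i (x $ i) * (\<Prod>j\<in>UNIV - {i}. f j (x $ j))"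
  using tensor_update[of f i "f i" x] by simp

lemma has_derivative_tensor:
  assumes "\<And>j s. (f j has_real_derivative f' j s) (at s)"
  shows "(tensor f has_derivative (\<lambda>h. (\<chi> i. tensor (f(i := f' i)) x) \<bullet> h)) (at x)"
proof -
  have "((\<lambda>x. f j (x $ j)) has_derivative (\<lambda>h. f' j (x $ j) * h $ j)) (at x)" for j
    using has_derivative_compose[of "\<lambda>x. x $ j" "\<lambda>h. h $ j" x UNIV "f j" "(*) (f' j (x $ j))"] assms
    by (simp add: has_field_derivative_def bounded_linear_imp_has_derivative bounded_linear_vec_nth)
  then have "((\<lambda>x. \<Prod>j\<in>UNIV. f j (x $ j)) has_derivative
      (\<lambda>h. \<Sum>i\<in>UNIV. f' i (x $ i) * h $ i * (\<Prod>j\<in>UNIV - {i}. f j (x $ j)))) (at x)"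
    by (intro has_derivative_prod) auto
  then show ?thesis
    unfolding tensor_def[of f, abs_def] inner_vec_def by (simp add: tensor_update mult_ac)
qed

lemma partial_deriv_tensor:
  assumes "\<And>j s. (f j has_real_derivative f' j s) (at s)"
  shows "partial_deriv i (tensor f) = tensor (f(i := f' i))"
  by (rule ext)
    (simp add: partial_deriv_def frechet_derivative_at[OF has_derivative_tensor[OF assms], symmetric] inner_axis)

lemma continuous_on_tensor:
  fixes f :: "'n::finite \<Rightarrow> real \<Rightarrow> real"
  assumes "\<And>j. continuous_on UNIV (f j)"
  shows "continuous_on S (tensor f)"
  unfolding tensor_def[abs_def]
proof (intro continuous_on_prod)
  fix j
  show "continuous_on S (\<lambda>x::real^'n. f j (x $ j))"
    by (rule continuous_on_compose2[OF assms]) (auto intro: continuous_intros)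
qed

text \<open>
  Partial derivatives of a product of functions of one coordinate are again such products, with one
  factor changed, so this lemma applies to them in turn.
\<close>
lemma C1_on_tensor:
  assumes "\<And>j s. (f j has_real_derivative f' j s) (at s)" "\<And>j. continuous_on UNIV (f' j)"
  shows "C1_on S (tensor f)"
  unfolding C1_on_def
proof (intro conjI ballI allI)
  fix x i
  show "tensor f differentiable at x"
    using has_derivative_tensor[OF assms(1)] by (rule differentiableI)
  have "continuous_on UNIV (f j)" for j
    using assms(1) by (meson DERIV_isCont continuous_at_imp_continuous_on)
  then show "continuous_on S (partial_deriv i (tensor f))"
    unfolding partial_deriv_tensor[OF assms(1)] by (intro continuous_on_tensor) (auto simp: assms(2))
qed

abbreviation cosine_mode :: "('n \<Rightarrow> real) \<Rightarrow> real^'n::finite \<Rightarrow> real" where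
  "cosine_mode \<nu> \<equiv> tensor (\<lambda>j s. cos (\<nu> j * s))"

abbreviation cosine_mode_deriv :: "('n \<Rightarrow> real) \<Rightarrow> 'n \<Rightarrow> real^'n::finite \<Rightarrow> real" where
  "cosine_mode_deriv \<nu> i \<equiv> tensor ((\<lambda>j s. cos (\<nu> j * s))(i := \<lambda>s. - (\<nu> i * sin (\<nu> i * s))))"

lemma cos_factor_deriv: "((\<lambda>s. cos (n * s)) has_real_derivative - (n * sin (n * s))) (at s)" for n s :: real
  by (auto intro!: derivative_eq_intros)

lemma sin_factor_deriv: "((\<lambda>s. - (n * sin (n * s))) has_real_derivative - (n\<^sup>2 * cos (n * s))) (at s)" for n s :: real
  by (auto intro!: derivative_eq_intros simp: power2_eq_square)

lemma updated_factor_deriv: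
  "(((\<lambda>j s. cos (\<nu> j * s))(i := \<lambda>s. - (\<nu> i * sin (\<nu> i * s)))) j has_real_derivative
    ((\<lambda>j s. - (\<nu> j * sin (\<nu> j * s)))(i := \<lambda>s. - ((\<nu> i)\<^sup>2 * cos (\<nu> i * s)))) j s) (at s)"
  for \<nu> :: "'n::finite \<Rightarrow> real"
  using cos_factor_deriv sin_factor_deriv by simp

lemma has_derivative_cosine_mode:
  "(cosine_mode \<nu> has_derivative (\<lambda>h. (\<chi> i. cosine_mode_deriv \<nu> i x) \<bullet> h)) (at x)"
  by (rule has_derivative_tensor) (rule cos_factor_deriv)

lemma partial_deriv_cosine_mode: "partial_deriv i (cosine_mode \<nu>) = cosine_mode_deriv \<nu> i"
  by (rule partial_deriv_tensor) (rule cos_factor_deriv)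

lemma cosine_mode_second_deriv:
  "tensor ((\<lambda>j s. cos (\<nu> j * s))(i := \<lambda>s. - ((\<nu> i)\<^sup>2 * cos (\<nu> i * s)))) x = - (\<nu> i)\<^sup>2 * cosine_mode \<nu> x"
  unfolding tensor_update by (subst tensor_remove[of _ x i]) simp

lemma partial_deriv_cosine_mode_deriv:
  "partial_deriv i (cosine_mode_deriv \<nu> i) x = - (\<nu> i)\<^sup>2 * cosine_mode \<nu> x"
proof -
  have "partial_deriv i (cosine_mode_deriv \<nu> i)
      = tensor (((\<lambda>j s. cos (\<nu> j * s))(i := \<lambda>s. - (\<nu> i * sin (\<nu> i * s))))
          (i := ((\<lambda>j s. - (\<nu> j * sin (\<nu> j * s)))(i := \<lambda>s. - ((\<nu> i)\<^sup>2 * cos (\<nu> i * s)))) i))"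
    by (rule partial_deriv_tensor) (rule updated_factor_deriv)
  then show ?thesis using cosine_mode_second_deriv[of \<nu> i x] by simp
qed

lemma laplacian_cosine_mode:
  "laplacian (cosine_mode \<nu>) x = - (\<Sum>i\<in>UNIV. (\<nu> i)\<^sup>2) * cosine_mode \<nu> x"
  unfolding laplacian_def partial_deriv_cosine_mode partial_deriv_cosine_mode_deriv
  by (simp add: sum_negf sum_distrib_right)

lemma C2_on_cosine_mode: "C2_on S (cosine_mode \<nu>)"
  unfolding C2_on_def partial_deriv_cosine_mode
proof (intro conjI allI)
  show "C1_on S (cosine_mode \<nu>)"
    by (rule C1_on_tensor, rule cos_factor_deriv) (intro continuous_intros)
  show "C1_on S (cosine_mode_deriv \<nu> i)" for i
    by (rule C1_on_tensor, rule updated_factor_deriv) (auto intro!: continuous_intros)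
qed

lemma continuous_on_cosine_mode_deriv: "continuous_on S (cosine_mode_deriv \<nu> i)"
  using C2_on_cosine_mode[of S \<nu>] by (simp add: C2_on_def C1_on_def partial_deriv_cosine_mode)

section \<open>Boxes and their normals\<close>

lemma closure_centred_box:
  assumes "\<And>i. a $ i > 0"
  shows "closure (centred_box a) = cbox (- a) a"
proof -
  have "0 \<in> centred_box a" using assms by (simp add: centred_box_def mem_box_cart)
  then show ?thesis unfolding centred_box_def by (intro closure_box) auto
qed

lemma mem_centred_box: "x \<in> centred_box a \<longleftrightarrow> (\<forall>i. \<bar>x $ i\<bar> < a $ i)"
  unfolding centred_box_def mem_box_cart by (auto simp: abs_less_iff) (metis minus_less_iff)+

lemma mem_closed_centred_box: fixes x :: "real^'n::finite" shows "x \<in> cbox (- a) a \<longleftrightarrow> (\<forall>i. \<bar>x $ i\<bar> \<le> a $ i)"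
  unfolding mem_box_cart by (auto simp: abs_le_iff) (metis minus_le_iff)+

lemma open_centred_box: "open (centred_box a)"
  by (simp add: centred_box_def open_box)

lemma frontier_centred_box:
  assumes "\<And>i. a $ i > 0"
  shows "x \<in> frontier (centred_box a) \<longleftrightarrow> (\<forall>i. \<bar>x $ i\<bar> \<le> a $ i) \<and> (\<exists>j. \<bar>x $ j\<bar> = a $ j)"
  unfolding frontier_def closure_centred_box[OF assms] interior_open[OF open_centred_box]
    Diff_iff mem_closed_centred_box mem_centred_box
  by (metis less_le not_le)

lemma norm_axis: "norm (axis j s :: real^'n::finite) = \<bar>s\<bar>"
proof -
  have "axis j s = s *\<^sub>R (axis j 1 :: real^'n)" by (simp add: vec_eq_iff axis_def)
  then show ?thesis by simp
qed

text \<open>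
  A direction \<open>h\<close> that leaves the box through the face \<open>j\<close> satisfies \<open>h \<bullet> \<nu> \<ge> 0\<close>, for otherwise a short
  step along \<open>h\<close> would lie in the cone that a normal \<open>\<nu>\<close> forces into the box. Perturbing tangential
  directions outwards, they satisfy \<open>h \<bullet> \<nu> \<ge> 0\<close> as well, together with their negatives, so \<open>\<nu>\<close>
  is orthogonal to the face. The argument applies at corners too: there it excludes any normal,
  as the conclusion cannot hold for two faces at once.
\<close>
lemma outward_normal_at_face_eq:
  fixes a x \<nu> :: "real^'n::finite"
  assumes a: "\<And>i. a $ i > 0" and normal: "outward_normal (centred_box a) x \<nu>" and j: "\<bar>x $ j\<bar> = a $ j"
  shows "\<nu> = axis j (sgn (x $ j))"
proof -
  define \<sigma> where "\<sigma> = sgn (x $ j)"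
  have "x $ j \<noteq> 0" using j a[of j] by auto
  then have \<sigma>: "\<sigma> * \<sigma> = 1" "\<bar>\<sigma>\<bar> = 1" "\<sigma> * x $ j = a $ j"
    using j by (auto simp: \<sigma>_def sgn_if)
  have norm: "norm \<nu> = 1" using normal by (simp add: outward_normal_def)
  have outward: "h \<bullet> \<nu> \<ge> 0" if h: "\<sigma> * h $ j > 0" for h
  proof (rule ccontr)
    assume neg: "\<not> h \<bullet> \<nu> \<ge> 0"
    then have nh: "norm h > 0" by auto
    \<comment> \<open>The slope of \<open>h\<close> against \<open>\<nu>\<close> is \<open>- 2 * e\<close>, safely inside the cone of parameter \<open>e\<close>.\<close>
    define e where "e = - (h \<bullet> \<nu>) / (2 * norm h)"
    have "e > 0" using neg nh by (simp add: e_def divide_neg_pos)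
    then obtain d where d: "d > 0"
      and D: "\<And>y. y \<in> ball x d \<Longrightarrow> (y - x) \<bullet> \<nu> < - e * norm (y - x) \<Longrightarrow> y \<in> centred_box a"
      using normal unfolding outward_normal_def by blast
    define s where "s = d / (2 * norm h)"
    have s: "s > 0" using d nh by (simp add: s_def)
    have "x + s *\<^sub>R h \<in> centred_box a"
    proof (rule D)
      show "x + s *\<^sub>R h \<in> ball x d"
        using d nh s by (simp add: dist_norm) (simp add: s_def)
      have "- e * norm (s *\<^sub>R h) = s * (h \<bullet> \<nu>) / 2"
        using nh s by (simp add: e_def)
      then show "(x + s *\<^sub>R h - x) \<bullet> \<nu> < - e * norm (x + s *\<^sub>R h - x)"
        using neg s mult_pos_neg[of s "h \<bullet> \<nu>"] by simp
    qed
    then have "\<bar>\<sigma> * (x $ j + s * h $ j)\<bar> < a $ j"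
      by (simp add: mem_centred_box abs_mult \<sigma>)
    moreover have "\<sigma> * (x $ j + s * h $ j) = a $ j + s * (\<sigma> * h $ j)"
      using \<sigma> by (simp add: algebra_simps)
    ultimately show False using mult_pos_pos[OF s h] by linarith
  qed
  have "\<bar>\<nu> $ j\<bar> \<le> 1" using component_le_norm_cart[of \<nu> j] norm by simp
  then have \<nu>j: "\<sigma> * \<nu> $ j \<le> 1" using \<sigma>(2) by (metis abs_le_D1 abs_mult mult_1)
  have tangential: "h \<bullet> \<nu> \<ge> 0" if h: "h $ j = 0" for h
  proof (rule ccontr)
    assume neg: "\<not> h \<bullet> \<nu> \<ge> 0"
    define \<delta> where "\<delta> = - (h \<bullet> \<nu>) / 2"
    have "\<delta> > 0" using neg by (simp add: \<delta>_def)
    then have "(h + axis j (\<delta> * \<sigma>)) \<bullet> \<nu> \<ge> 0"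
      using \<sigma> h by (intro outward) (simp add: mult.left_commute)
    then have "h \<bullet> \<nu> + \<delta> * (\<sigma> * \<nu> $ j) \<ge> 0"
      by (simp add: inner_add_left inner_axis' mult.assoc)
    moreover have "\<delta> * (\<sigma> * \<nu> $ j) \<le> \<delta>" using \<nu>j \<open>\<delta> > 0\<close> by simp
    ultimately show False using neg by (simp add: \<delta>_def)
  qed
  have "\<nu> $ i = 0" if "i \<noteq> j" for i
  proof -
    have "axis i s $ j = 0" for s :: real using that by (simp add: axis_def)
    then show ?thesis
      using tangential[of "axis i 1"] tangential[of "axis i (-1)"] by (simp add: inner_axis')
  qed
  then have \<nu>: "\<nu> = axis j (\<nu> $ j)" by (auto simp: vec_eq_iff axis_def)
  then have "\<bar>\<nu> $ j\<bar> = 1" using norm by (metis norm_axis real_norm_def)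
  moreover have "\<sigma> * \<nu> $ j \<ge> 0"
    using outward[of "axis j \<sigma>"] \<sigma> by (simp add: inner_axis')
  ultimately have "\<nu> $ j = \<sigma>" using \<sigma>(2) by (auto simp: abs_if split: if_splits)
  then show ?thesis using \<nu> by (simp add: \<sigma>_def)
qed

text \<open>
  Within distance \<open>d\<close> of such a point, a point belongs to the box if and only if it lies on the inner
  side of the face \<open>j\<close>: all other faces are at distance at least \<open>d\<close>.
\<close>
lemma outward_normal_at_open_face:
  fixes a x :: "real^'n::finite"
  assumes a: "\<And>i. a $ i > 0" and j: "\<bar>x $ j\<bar> = a $ j" and others: "\<And>i. i \<noteq> j \<Longrightarrow> \<bar>x $ i\<bar> < a $ i"
  shows "outward_normal (centred_box a) x (axis j (sgn (x $ j)))"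
proof -
  define \<sigma> where "\<sigma> = sgn (x $ j)"
  have "x $ j \<noteq> 0" using j a[of j] by auto
  then have \<sigma>: "\<bar>\<sigma>\<bar> = 1" "\<sigma> * x $ j = a $ j"
    using j by (auto simp: \<sigma>_def sgn_if)
  have "\<bar>x $ i\<bar> \<le> a $ i" for i using j others[of i] by (cases "i = j") auto
  then have frontier: "x \<in> frontier (centred_box a)"
    unfolding frontier_centred_box[OF a] using j by auto
  define d where "d = Min (insert (a $ j) ((\<lambda>i. a $ i - \<bar>x $ i\<bar>) ` (UNIV - {j})))"
  have d: "d > 0" using a others unfolding d_def by (subst Min_gr_iff) auto
  have di: "d \<le> a $ i - \<bar>x $ i\<bar>" if "i \<noteq> j" for i
    using that unfolding d_def by auto
  have "d \<le> a $ j" unfolding d_def by auto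
  have "((y - x) \<bullet> axis j \<sigma> < - e * norm (y - x) \<longrightarrow> y \<in> centred_box a) \<and>
      ((y - x) \<bullet> axis j \<sigma> > e * norm (y - x) \<longrightarrow> y \<notin> centred_box a)"
    if e: "e > 0" and y: "y \<in> ball x d" for e y
  proof -
    have close: "\<bar>y $ i - x $ i\<bar> < d" for i
      using y component_le_norm_cart[of "y - x" i] by (simp add: dist_norm norm_minus_commute)
    have inner: "(y - x) \<bullet> axis j \<sigma> = \<sigma> * y $ j - a $ j"
      using \<sigma> by (simp add: inner_axis algebra_simps)
    have nn: "e * norm (y - x) \<ge> 0" using e by simp
    have "y \<in> centred_box a" if lt: "\<sigma> * y $ j < a $ j"
      unfolding mem_centred_box
    proof
      fix i
      show "\<bar>y $ i\<bar> < a $ i"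
      proof (cases "i = j")
        case True
        have "\<bar>\<sigma> * (y $ j - x $ j)\<bar> < d" using close[of j] by (simp add: abs_mult \<sigma>)
        then have "\<bar>\<sigma> * y $ j - a $ j\<bar> < d" using \<sigma> by (simp add: right_diff_distrib)
        then have "\<bar>\<sigma> * y $ j\<bar> < a $ j" using lt \<open>d \<le> a $ j\<close> by linarith
        then show ?thesis using True by (simp add: abs_mult \<sigma>)
      next
        case False
        then show ?thesis using close[of i] di[OF False] by linarith
      qed
    qed
    moreover have "y \<notin> centred_box a" if gt: "\<sigma> * y $ j > a $ j"
    proof -
      have "\<bar>\<sigma> * y $ j\<bar> > a $ j" using gt by linarith
      then have "\<bar>y $ j\<bar> > a $ j" by (simp add: abs_mult \<sigma>)
      then show ?thesis unfolding mem_centred_box by (metis less_asym)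
    qed
    ultimately show ?thesis unfolding inner using nn by auto
  qed
  then show ?thesis
    unfolding outward_normal_def \<sigma>_def[symmetric] using frontier d \<sigma>(1) by (auto simp: norm_axis)
qed

section \<open>The fundamental eigenvalue of a box\<close>

lemma robin_eigenfunction_cosine_mode:
  fixes a :: "real^'n::finite"
  assumes \<beta>: "\<beta> \<ge> 0" and a: "\<And>i. a $ i > 0"
  defines "\<mu> \<equiv> (\<lambda>i. robin_freq \<beta> (a $ i))"
  shows "robin_eigenfunction \<beta> (centred_box a) (freq_sq_sum \<beta> a) (cosine_mode \<mu>)"
  unfolding robin_eigenfunction_def
proof (intro conjI ballI exI allI impI)
  have "cosine_mode \<mu> 0 \<noteq> 0" "(0::real^'n) \<in> centred_box a"
    using a by (simp_all add: tensor_def mem_centred_box)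
  then show "\<exists>x\<in>centred_box a. cosine_mode \<mu> x \<noteq> 0" by blast
  show "C2_on (centred_box a) (cosine_mode \<mu>)" by (rule C2_on_cosine_mode)
  show "laplacian (cosine_mode \<mu>) x + freq_sq_sum \<beta> a * cosine_mode \<mu> x = 0" for x
    by (simp add: laplacian_cosine_mode freq_sq_sum_def \<mu>_def)
  show "C1_closure_grad (centred_box a) (cosine_mode \<mu>) (\<lambda>x. \<chi> i. cosine_mode_deriv \<mu> i x)"
    unfolding C1_closure_grad_def
    by (intro conjI ballI continuous_on_vec_lambda continuous_on_cosine_mode_deriv
        has_derivative_at_withinI[OF has_derivative_cosine_mode])
  fix x \<nu> :: "real^'n" assume normal: "outward_normal (centred_box a) x \<nu>"
  then obtain j where j: "\<bar>x $ j\<bar> = a $ j"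
    using frontier_centred_box[of a x] a by (auto simp: outward_normal_def)
  define \<sigma> where "\<sigma> = sgn (x $ j)"
  have "x $ j \<noteq> 0" using j a[of j] by auto
  then have x: "x $ j = \<sigma> * a $ j" and \<sigma>: "\<sigma> = 1 \<or> \<sigma> = -1"
    using j by (auto simp: \<sigma>_def sgn_if)
  have \<nu>: "\<nu> = axis j \<sigma>"
    using outward_normal_at_face_eq[OF a normal j] by (simp add: \<sigma>_def)
  define R where "R = (\<Prod>k\<in>UNIV - {j}. cos (\<mu> k * x $ k))"
  have "(\<chi> i. cosine_mode_deriv \<mu> i x) \<bullet> \<nu> = - (\<mu> j * sin (\<mu> j * a $ j)) * R"
    using \<sigma> by (auto simp: \<nu> inner_axis tensor_update x R_def)
  moreover have "cosine_mode \<mu> x = cos (\<mu> j * a $ j) * R"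
    using \<sigma> by (subst tensor_remove[of _ x j]) (auto simp: x R_def)
  moreover have "cos (\<mu> j * a $ j) = \<beta> * \<mu> j * sin (\<mu> j * a $ j)"
    using robin_freq_boundary[OF \<beta> a[of j]] by (simp add: \<mu>_def)
  ultimately show "\<beta> * ((\<chi> i. cosine_mode_deriv \<mu> i x) \<bullet> \<nu>) + cosine_mode \<mu> x = 0"
    by simp
qed

text \<open>
  The second derivative test, along a line through an interior maximum. Since \<open>f' 0 = 0\<close>, a positive
  second derivative would make \<open>f'\<close> positive, hence \<open>f\<close> increasing, just to the right of \<open>0\<close>.
\<close>
lemma local_max_second_deriv_nonpos:
  fixes f f' :: "real \<Rightarrow> real"
  assumes d: "d > 0"
    and f': "\<And>t. \<bar>t\<bar> < d \<Longrightarrow> (f has_real_derivative f' t) (at t)"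
    and D: "(f' has_real_derivative D) (at 0)"
    and max: "\<And>t. \<bar>t\<bar> < d \<Longrightarrow> f t \<le> f 0"
  shows "D \<le> 0"
proof (rule ccontr)
  assume "\<not> D \<le> 0"
  have "f' 0 = 0"
    using DERIV_local_max[OF f'[of 0] d] max d by simp
  then obtain e where e: "e > 0" and inc: "\<And>h. 0 < h \<Longrightarrow> h < e \<Longrightarrow> f' h > 0"
    using DERIV_pos_inc_right[OF D] \<open>\<not> D \<le> 0\<close> by auto
  define h where "h = min d e / 2"
  have h: "0 < h" "h < d" "h < e" using d e by (auto simp: h_def min_def)
  have "\<exists>z>0. z < h \<and> f h - f 0 = (h - 0) * f' z"
    by (rule MVT2) (use h f' in auto)
  then obtain z where "0 < z" "z < h" "f h - f 0 = h * f' z" by auto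
  then have "f h > f 0" using inc[of z] h by (smt (verit) mult_pos_pos)
  then show False using max[of h] h by simp
qed

text \<open>
  Derivatives relative to \<open>S\<close> are needed at boundary points, where only inward segments are available.
\<close>
lemma has_real_derivative_along_line:
  fixes u :: "'a::real_normed_vector \<Rightarrow> real"
  assumes u: "(u has_derivative u') (at (x + t *\<^sub>R h) within S)"
    and line: "\<And>r. r \<in> T \<Longrightarrow> x + r *\<^sub>R h \<in> S"
  shows "((\<lambda>r. u (x + r *\<^sub>R h)) has_real_derivative u' h) (at t within T)"
proof -
  have "((\<lambda>r. x + r *\<^sub>R h) has_derivative (\<lambda>r. r *\<^sub>R h)) (at t within T)"
    by (auto intro!: derivative_eq_intros)
  moreover have "(u has_derivative u') (at (x + t *\<^sub>R h) within (\<lambda>r. x + r *\<^sub>R h) ` T)"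
    using u by (rule has_derivative_subset) (use line in auto)
  ultimately have "((\<lambda>r. u (x + r *\<^sub>R h)) has_derivative (\<lambda>r. u' (r *\<^sub>R h))) (at t within T)"
    by (rule has_derivative_in_compose)
  moreover have "linear u'" using u has_derivative_linear by blast
  ultimately show ?thesis
    by (simp add: has_field_derivative_def linear_cmul mult.commute[of _ "u' h"])
qed

lemma C1_has_derivative_axis:
  assumes "C1_on S u" "x + t *\<^sub>R axis i 1 \<in> S"
  shows "((\<lambda>t. u (x + t *\<^sub>R axis i 1)) has_real_derivative partial_deriv i u (x + t *\<^sub>R axis i 1)) (at t)"
  unfolding partial_deriv_def
  by (rule has_real_derivative_along_line[where S = UNIV])
    (use assms in \<open>auto simp: C1_on_def frechet_derivative_works[symmetric]\<close>)

text \<open>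
  On edges and corners no outward normal exists, so the Robin condition is not imposed there. It
  nevertheless holds for each adjacent face, by continuity of \<open>u\<close> and its gradient up to the boundary:
  \<open>x\<close> is approached from the relative interior of the face by shrinking its other coordinates.
\<close>
lemma robin_condition_closed_face:
  fixes a :: "real^'n::finite"
  assumes a: "\<And>i. a $ i > 0"
    and g: "C1_closure_grad (centred_box a) u g"
    and robin: "\<And>x \<nu>. outward_normal (centred_box a) x \<nu> \<Longrightarrow> \<beta> * (g x \<bullet> \<nu>) + u x = 0"
    and x: "x \<in> cbox (- a) a" and j: "\<bar>x $ j\<bar> = a $ j"
  shows "\<beta> * (g x \<bullet> axis j (sgn (x $ j))) + u x = 0"
proof -
  define y where "y s = (\<chi> i. if i = j then x $ j else s * x $ i)" for s :: real
  define F where "F s = \<beta> * (g (y s) \<bullet> axis j (sgn (x $ j))) + u (y s)" for s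
  have abs_x: "\<bar>x $ i\<bar> \<le> a $ i" for i using x by (simp add: mem_closed_centred_box)
  have y_in: "y s \<in> cbox (- a) a" if "s \<in> {0..1}" for s
    unfolding mem_closed_centred_box
  proof
    fix i
    have "\<bar>s * x $ i\<bar> \<le> 1 * a $ i"
      unfolding abs_mult using that abs_x[of i] by (intro mult_mono) auto
    then show "\<bar>y s $ i\<bar> \<le> a $ i" using j by (simp add: y_def)
  qed
  have closure: "closure (centred_box a) = cbox (- a) a" by (rule closure_centred_box[OF a])
  have y_cont: "continuous_on {0..1} y"
    unfolding y_def[abs_def]
  proof (rule continuous_on_vec_lambda)
    show "continuous_on {0..1} (\<lambda>s. if i = j then x $ j else s * x $ i)" for i
      by (cases "i = j") (auto intro: continuous_intros)
  qed
  have "continuous_on (cbox (- a) a) g" "continuous_on (cbox (- a) a) u"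
    using g has_derivative_continuous_on[of "cbox (- a) a" u "\<lambda>x h. g x \<bullet> h"]
    unfolding C1_closure_grad_def closure by auto
  then have "continuous_on {0..1} (\<lambda>s. g (y s))" "continuous_on {0..1} (\<lambda>s. u (y s))"
    using y_cont y_in by (auto intro: continuous_on_compose2)
  then have "continuous_on {0..1} F"
    unfolding F_def[abs_def] by (intro continuous_intros)
  moreover have "F s = 0" if s: "s \<in> {0<..<1}" for s
  proof -
    have "\<bar>y s $ j\<bar> = a $ j" using j by (simp add: y_def)
    moreover have "\<bar>y s $ i\<bar> < a $ i" if "i \<noteq> j" for i
    proof -
      have "s * \<bar>x $ i\<bar> \<le> s * a $ i" using s abs_x[of i] by simp
      also have "\<dots> < a $ i" using s a[of i] by simp
      finally show ?thesis using s that by (simp add: y_def abs_mult)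
    qed
    ultimately have "outward_normal (centred_box a) (y s) (axis j (sgn (y s $ j)))"
      by (rule outward_normal_at_open_face[OF a])
    then show ?thesis using robin by (simp add: F_def y_def)
  qed
  ultimately have "F 1 = 0"
    using continuous_constant_on_closure[of "{0<..<1}" F 0 1] by simp
  moreover have "y 1 = x" by (simp add: y_def vec_eq_iff)
  ultimately show ?thesis by (simp add: F_def)
qed

text \<open>
  Let \<open>\<phi>\<close> be the product of the functions \<open>cos (\<nu> i * x $ i)\<close>, which is positive on the closed box, and let
  \<open>M\<close> be the maximum of \<open>\<bar>u\<bar> / \<phi>\<close>, attained at \<open>x0\<close>. With \<open>s\<close> the sign of \<open>u x0\<close>, the function
  \<open>s * u - M * \<phi>\<close> is nonpositive and vanishes at \<open>x0\<close>. If \<open>x0\<close> is an interior point, its Laplacian there is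
  nonpositive, that is \<open>(\<Sum>i. (\<nu> i)\<^sup>2) - l \<le> 0\<close>. If \<open>x0\<close> lies on a face, its outward normal derivative
  there is nonnegative; by the Robin condition for \<open>u\<close> this says \<open>\<beta> * \<partial>\<^sub>n \<phi> + \<phi> \<le> 0\<close>, contrary to
  the strict inequality that \<open>\<phi>\<close> satisfies.
\<close>
lemma robin_eigenvalue_lower_bound:
  fixes a :: "real^'n::finite"
  assumes \<beta>: "\<beta> \<ge> 0" and a: "\<And>i. a $ i > 0"
    and \<nu>: "\<And>i. \<nu> i > 0" "\<And>i. a $ i * \<nu> i + arctan (\<beta> * \<nu> i) < pi / 2"
    and eigen: "robin_eigenvalue \<beta> (centred_box a) l"
  shows "(\<Sum>i\<in>UNIV. (\<nu> i)\<^sup>2) \<le> l"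
proof (rule ccontr)
  assume less: "\<not> (\<Sum>i\<in>UNIV. (\<nu> i)\<^sup>2) \<le> l"
  let ?B = "cbox (- a) a" and ?\<phi> = "cosine_mode \<nu>"
  obtain u g x1 where x1: "x1 \<in> centred_box a" "u x1 \<noteq> 0"
    and C2: "C2_on (centred_box a) u"
    and pde: "\<And>x. x \<in> centred_box a \<Longrightarrow> laplacian u x + l * u x = 0"
    and g: "C1_closure_grad (centred_box a) u g"
    and robin: "\<And>x \<nu>. outward_normal (centred_box a) x \<nu> \<Longrightarrow> \<beta> * (g x \<bullet> \<nu>) + u x = 0"
    using eigen unfolding robin_eigenvalue_def robin_eigenfunction_def by metis
  have closure: "closure (centred_box a) = ?B" by (rule closure_centred_box[OF a])
  have u_deriv: "(u has_derivative (\<lambda>h. g x \<bullet> h)) (at x within ?B)" if "x \<in> ?B" for x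
    using g that by (simp add: C1_closure_grad_def closure)
  then have u_cont: "continuous_on ?B u" by (rule has_derivative_continuous_on)
  have factor_pos: "cos (\<nu> i * x $ i) > 0" if "x \<in> ?B" for x i
  proof -
    have "\<bar>\<nu> i * x $ i\<bar> \<le> \<nu> i * a $ i"
      using that \<nu>(1)[of i] by (simp add: mem_closed_centred_box abs_mult)
    moreover have "arctan (\<beta> * \<nu> i) \<ge> 0" using \<beta> \<nu>(1)[of i] by simp
    ultimately have "\<bar>\<nu> i * x $ i\<bar> < pi / 2"
      using \<nu>(2)[of i] mult.commute[of "a $ i" "\<nu> i"] by linarith
    then show ?thesis by (intro cos_gt_zero_pi) auto
  qed
  then have \<phi>_pos: "?\<phi> x > 0" if "x \<in> ?B" for x
    using that unfolding tensor_def by (intro prod_pos) auto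
  have \<phi>_cont: "continuous_on ?B ?\<phi>"
    by (intro continuous_on_tensor continuous_intros)
  have "x1 \<in> ?B" using x1 closure closure_subset by blast
  have "continuous_on ?B (\<lambda>x. \<bar>u x\<bar> / ?\<phi> x)"
    using \<phi>_pos by (intro continuous_intros u_cont \<phi>_cont) (metis less_irrefl)
  then obtain x0 where x0: "x0 \<in> ?B" and max: "\<And>y. y \<in> ?B \<Longrightarrow> \<bar>u y\<bar> / ?\<phi> y \<le> \<bar>u x0\<bar> / ?\<phi> x0"
    using continuous_attains_sup[OF compact_cbox, of "- a" a] \<open>x1 \<in> ?B\<close> by blast
  define M where "M = \<bar>u x0\<bar> / ?\<phi> x0"
  have "0 < \<bar>u x1\<bar> / ?\<phi> x1" using x1 \<phi>_pos[OF \<open>x1 \<in> ?B\<close>] by simp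
  also have "\<dots> \<le> M" unfolding M_def by (rule max[OF \<open>x1 \<in> ?B\<close>])
  finally have M: "M > 0" .
  have dominated: "\<bar>u y\<bar> \<le> M * ?\<phi> y" if "y \<in> ?B" for y
    using max[OF that, folded M_def] \<phi>_pos[OF that] by (simp only: pos_divide_le_eq)
  define s where "s = sgn (u x0)"
  have touch: "s * u x0 = M * ?\<phi> x0"
    using \<phi>_pos[OF x0] abs_sgn[of "u x0"] by (simp add: M_def s_def mult.commute)
  have s: "\<bar>s\<bar> \<le> 1" by (simp add: s_def abs_sgn_eq)
  have below: "s * u y - M * ?\<phi> y \<le> s * u x0 - M * ?\<phi> x0" if "y \<in> ?B" for y
  proof -
    have "s * u y \<le> \<bar>s\<bar> * \<bar>u y\<bar>" by (metis abs_ge_self abs_mult)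
    also have "\<dots> \<le> 1 * \<bar>u y\<bar>" using s by (intro mult_right_mono) auto
    finally show ?thesis using dominated[OF that] touch by simp
  qed
  show False
  proof (cases "x0 \<in> centred_box a")
    case True
    obtain d where d: "d > 0" and ball: "ball x0 d \<subseteq> centred_box a"
      using open_centred_box True open_contains_ball by blast
    have second: "s * partial_deriv i (partial_deriv i u) x0 + M * (\<nu> i)\<^sup>2 * ?\<phi> x0 \<le> 0" for i
    proof (rule local_max_second_deriv_nonpos[OF d])
      let ?y = "\<lambda>t. x0 + t *\<^sub>R axis i (1::real)"
      have y: "?y t \<in> centred_box a" if "\<bar>t\<bar> < d" for t
        using ball that by (intro subsetD[OF ball]) (simp add: dist_norm)
      have C1: "C1_on (centred_box a) u" "C1_on (centred_box a) (partial_deriv i u)"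
        "C1_on UNIV ?\<phi>" "C1_on UNIV (cosine_mode_deriv \<nu> i)"
        using C2 C2_on_cosine_mode[of UNIV \<nu>] by (auto simp: C2_on_def partial_deriv_cosine_mode)
      show "((\<lambda>t. s * u (?y t) - M * ?\<phi> (?y t)) has_real_derivative
          s * partial_deriv i u (?y t) - M * cosine_mode_deriv \<nu> i (?y t)) (at t)" if "\<bar>t\<bar> < d" for t
        using C1_has_derivative_axis[OF C1(1) y[OF that]] C1_has_derivative_axis[OF C1(3), of x0 t i]
        by (intro DERIV_diff DERIV_cmult) (auto simp: partial_deriv_cosine_mode)
      have "((\<lambda>t. s * partial_deriv i u (?y t) - M * cosine_mode_deriv \<nu> i (?y t)) has_real_derivative
          s * partial_deriv i (partial_deriv i u) (?y 0)
            - M * partial_deriv i (cosine_mode_deriv \<nu> i) (?y 0)) (at 0)"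
        using d by (intro DERIV_diff DERIV_cmult C1_has_derivative_axis[OF C1(2) y] C1_has_derivative_axis[OF C1(4)]) auto
      then show "((\<lambda>t. s * partial_deriv i u (?y t) - M * cosine_mode_deriv \<nu> i (?y t)) has_real_derivative
          s * partial_deriv i (partial_deriv i u) x0 + M * (\<nu> i)\<^sup>2 * ?\<phi> x0) (at 0)"
        by (simp add: partial_deriv_cosine_mode_deriv mult.assoc)
      show "s * u (?y t) - M * ?\<phi> (?y t) \<le> s * u (?y 0) - M * ?\<phi> (?y 0)" if "\<bar>t\<bar> < d" for t
        using below y[OF that] closure closure_subset by auto
    qed
    have "(\<Sum>i\<in>UNIV. s * partial_deriv i (partial_deriv i u) x0 + M * (\<nu> i)\<^sup>2 * ?\<phi> x0) \<le> 0"
      by (intro sum_nonpos second)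
    then have "s * laplacian u x0 + M * (\<Sum>i\<in>UNIV. (\<nu> i)\<^sup>2) * ?\<phi> x0 \<le> 0"
      by (simp add: laplacian_def sum.distrib sum_distrib_left sum_distrib_right)
    moreover have "s * laplacian u x0 = - l * (M * ?\<phi> x0)"
    proof -
      have "laplacian u x0 = - l * u x0" using pde[OF True] by simp
      then show ?thesis unfolding touch[symmetric] by simp
    qed
    ultimately have "M * ?\<phi> x0 * ((\<Sum>i\<in>UNIV. (\<nu> i)\<^sup>2) - l) \<le> 0"
      by (simp add: algebra_simps)
    then show False
      using less mult_pos_pos[OF mult_pos_pos[OF M \<phi>_pos[OF x0]], of "(\<Sum>i\<in>UNIV. (\<nu> i)\<^sup>2) - l"] by linarith
  next
    case False
    then obtain j where j: "\<bar>x0 $ j\<bar> = a $ j"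
      using x0 unfolding mem_centred_box mem_closed_centred_box by (metis less_le)
    define \<sigma> where "\<sigma> = sgn (x0 $ j)"
    have "x0 $ j \<noteq> 0" using j a[of j] by auto
    then have x0j: "x0 $ j = \<sigma> * a $ j" and \<sigma>: "\<sigma> = 1 \<or> \<sigma> = -1"
      using j by (auto simp: \<sigma>_def sgn_if)
    \<comment> \<open>A corner lies on several faces; any one of them, with its normal \<open>?n\<close>, will do.\<close>
    let ?n = "axis j \<sigma> :: real^'n"
    have "\<beta> * (g x0 \<bullet> ?n) + u x0 = 0"
      unfolding \<sigma>_def by (rule robin_condition_closed_face[OF a g robin x0 j])
    then have "u x0 = - (\<beta> * (g x0 \<bullet> ?n))" by linarith
    then have robin_x0: "s * u x0 = - (\<beta> * (s * (g x0 \<bullet> ?n)))" by simp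
    define G where "G = (\<chi> i. cosine_mode_deriv \<nu> i x0) \<bullet> ?n"
    \<comment> \<open>The inward segment from \<open>x0\<close> stays in the closed box until it meets the opposite face.\<close>
    let ?T = "{0..2 * a $ j}"
    have line: "x0 + t *\<^sub>R (- ?n) \<in> ?B" if t: "t \<in> ?T" for t
      unfolding mem_closed_centred_box
    proof
      fix i
      show "\<bar>(x0 + t *\<^sub>R (- ?n)) $ i\<bar> \<le> a $ i"
      proof (cases "i = j")
        case True
        have "(x0 + t *\<^sub>R (- ?n)) $ j = \<sigma> * (a $ j - t)"
          by (simp add: x0j right_diff_distrib mult.commute)
        moreover have "\<bar>\<sigma> * (a $ j - t)\<bar> = \<bar>a $ j - t\<bar>" using \<sigma> by auto
        ultimately show ?thesis using True t by auto
      next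
        case False
        then have "(x0 + t *\<^sub>R (- ?n)) $ i = x0 $ i" by (simp add: axis_def)
        then show ?thesis using x0 by (simp only: mem_closed_centred_box)
      qed
    qed
    define v where "v t = s * u (x0 + t *\<^sub>R (- ?n)) - M * ?\<phi> (x0 + t *\<^sub>R (- ?n))" for t
    have "(v has_real_derivative
        s * (g x0 \<bullet> (- ?n)) - M * ((\<chi> i. cosine_mode_deriv \<nu> i x0) \<bullet> (- ?n))) (at 0 within ?T)"
      unfolding v_def[abs_def]
    proof (intro DERIV_diff DERIV_cmult)
      show "((\<lambda>t. u (x0 + t *\<^sub>R (- ?n))) has_real_derivative g x0 \<bullet> (- ?n)) (at 0 within ?T)"
      proof (rule has_real_derivative_along_line[where S = ?B])
        show "(u has_derivative (\<lambda>h. g x0 \<bullet> h)) (at (x0 + 0 *\<^sub>R (- ?n)) within ?B)"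
          using u_deriv[OF x0] by (simp only: scaleR_zero_left add_0_right)
      qed (rule line)
      show "((\<lambda>t. ?\<phi> (x0 + t *\<^sub>R (- ?n))) has_real_derivative
          (\<chi> i. cosine_mode_deriv \<nu> i x0) \<bullet> (- ?n)) (at 0 within ?T)"
      proof (rule has_real_derivative_along_line[where S = UNIV])
        show "(?\<phi> has_derivative (\<lambda>h. (\<chi> i. cosine_mode_deriv \<nu> i x0) \<bullet> h)) (at (x0 + 0 *\<^sub>R (- ?n)))"
          using has_derivative_cosine_mode[of \<nu> x0] by (simp only: scaleR_zero_left add_0_right)
      qed (rule UNIV_I)
    qed
    then have deriv: "(v has_real_derivative M * G - s * (g x0 \<bullet> ?n)) (at 0 within ?T)"
      by (rule DERIV_cong) (simp only: G_def inner_minus_right mult_minus_right minus_diff_minus minus_diff_eq)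
    have v_max: "v t \<le> v 0" if "t \<in> ?T" for t
      using below[OF line[OF that]] by (simp only: v_def scaleR_zero_left add_0_right)
    have "M * G - s * (g x0 \<bullet> ?n) \<le> 0"
    proof (rule ccontr)
      assume "\<not> ?thesis"
      then obtain d where d: "d > 0" and inc: "\<And>h. 0 < h \<Longrightarrow> 0 + h \<in> ?T \<Longrightarrow> h < d \<Longrightarrow> v 0 < v (0 + h)"
        using has_real_derivative_pos_inc_right[OF deriv] unfolding not_le by blast
      define h where "h = min d (a $ j) / 2"
      have h: "0 < h" "h \<in> ?T" "h < d" using d a[of j] by (auto simp: h_def min_def)
      then show False using inc[of h] v_max[of h] by simp
    qed
    then have "\<beta> * (M * G) \<le> \<beta> * (s * (g x0 \<bullet> ?n))" using \<beta> by (intro mult_left_mono) auto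
    then have "M * ?\<phi> x0 \<le> M * (- \<beta> * G)" using robin_x0 touch by (simp add: algebra_simps)
    then have le: "?\<phi> x0 \<le> - \<beta> * G" using M by (simp only: mult_le_cancel_left_pos)
    define R where "R = (\<Prod>k\<in>UNIV - {j}. cos (\<nu> k * x0 $ k))"
    have R: "R > 0" unfolding R_def using factor_pos[OF x0] by (intro prod_pos) auto
    have "G = - (\<nu> j * sin (\<nu> j * a $ j)) * R"
      using \<sigma> by (auto simp: G_def inner_axis tensor_update x0j R_def)
    moreover have "?\<phi> x0 = cos (\<nu> j * a $ j) * R"
      using \<sigma> by (subst tensor_remove[of _ x0 j]) (auto simp: x0j R_def)
    ultimately have "cos (\<nu> j * a $ j) * R \<le> (\<beta> * \<nu> j * sin (\<nu> j * a $ j)) * R"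
      using le by (simp add: mult.assoc)
    then have "cos (\<nu> j * a $ j) \<le> \<beta> * \<nu> j * sin (\<nu> j * a $ j)" using R by simp
    then show False using below_freq_boundary[OF \<beta> a \<nu>] by (metis not_le)
  qed
qed

text \<open>
  The product of cosines shows that \<open>freq_sq_sum \<beta> a\<close> is an eigenvalue. No eigenvalue \<open>l\<close> is smaller:
  scaling all frequencies by \<open>sqrt z < 1\<close> makes them subcritical, whence \<open>z * freq_sq_sum \<beta> a \<le> l\<close>, and
  \<open>z\<close> may tend to \<open>1\<close>.
\<close>
lemma robin_lambda1_centred_box:
  fixes a :: "real^'n::finite"
  assumes \<beta>: "\<beta> \<ge> 0" and a: "\<And>i. a $ i > 0"
  shows "robin_lambda1 \<beta> (centred_box a) = freq_sq_sum \<beta> a"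
  unfolding robin_lambda1_def
proof (rule Least_equality)
  show "robin_eigenvalue \<beta> (centred_box a) (freq_sq_sum \<beta> a)"
    unfolding robin_eigenvalue_def using robin_eigenfunction_cosine_mode[OF \<beta> a] by blast
  fix l assume eigen: "robin_eigenvalue \<beta> (centred_box a) l"
  show "freq_sq_sum \<beta> a \<le> l"
  proof (rule field_le_mult_one_interval)
    fix z :: real assume z: "0 < z" "z < 1"
    define \<nu> where "\<nu> i = sqrt z * robin_freq \<beta> (a $ i)" for i
    have "\<nu> i > 0" for i using z robin_freq_pos[OF \<beta> a] by (simp add: \<nu>_def)
    moreover have "a $ i * \<nu> i + arctan (\<beta> * \<nu> i) < pi / 2" for i
    proof -
      have "\<nu> i < robin_freq \<beta> (a $ i)" using z robin_freq_pos[OF \<beta> a[of i]] by (simp add: \<nu>_def)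
      from freq_equation_strict_mono[OF \<beta> a[of i] this] show ?thesis
        using robin_freq_eq[OF \<beta> a[of i]] by simp
    qed
    ultimately have "(\<Sum>i\<in>UNIV. (\<nu> i)\<^sup>2) \<le> l"
      by (rule robin_eigenvalue_lower_bound[OF \<beta> a _ _ eigen])
    then show "z * freq_sq_sum \<beta> a \<le> l"
      using z by (simp add: \<nu>_def freq_sq_sum_def power_mult_distrib sum_distrib_left)
  qed
qed

section \<open>Minkowski combinations\<close>

text \<open>
  A point \<open>z\<close> of the combined box is split by scaling: the ratios \<open>z $ i / c $ i\<close>, all of modulus
  below \<open>1\<close>, are transferred to the half-widths \<open>a\<close> and \<open>b\<close>.
\<close>
lemma centred_box_Minkowski:
  fixes a b :: "real^'n::finite"
  assumes a: "\<And>i. a $ i > 0" and b: "\<And>i. b $ i > 0" and t: "t \<in> {0..1}"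
  shows "centred_box ((1 - t) *\<^sub>R a + t *\<^sub>R b)
    = {(1 - t) *\<^sub>R x + t *\<^sub>R y | x y. x \<in> centred_box a \<and> y \<in> centred_box b}" (is "?L = ?R")
proof
  define c where "c = (1 - t) *\<^sub>R a + t *\<^sub>R b"
  have strict: "(1 - t) * p + t * q < (1 - t) * p' + t * q'" if "p < p'" "q < q'" for p q p' q' :: real
    using t that by (cases "t = 0") (auto intro!: add_le_less_mono mult_left_mono)
  have c: "c $ i > 0" for i using strict[of 0 "a $ i" 0 "b $ i"] a b by (simp add: c_def)
  show "?L \<subseteq> ?R"
  proof
    fix z assume "z \<in> ?L"
    then have z: "\<bar>z $ i\<bar> < c $ i" for i by (simp add: mem_centred_box c_def)
    define x y :: "real^'n" where "x = (\<chi> i. z $ i / c $ i * a $ i)" and "y = (\<chi> i. z $ i / c $ i * b $ i)"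
    have ratio: "\<bar>z $ i / c $ i\<bar> < 1" for i using z[of i] c[of i] by (simp add: abs_divide)
    have "\<bar>x $ i\<bar> < a $ i" "\<bar>y $ i\<bar> < b $ i" for i
      using mult_strict_right_mono[OF ratio a] mult_strict_right_mono[OF ratio b] a[of i] b[of i]
      by (simp_all add: x_def y_def abs_mult)
    moreover have "z = (1 - t) *\<^sub>R x + t *\<^sub>R y"
    proof (simp add: vec_eq_iff, intro allI)
      fix i
      have "(1 - t) * (q * a $ i) + t * (q * b $ i) = q * c $ i" for q
        by (simp add: c_def algebra_simps)
      then have "(1 - t) * x $ i + t * y $ i = z $ i / c $ i * c $ i"
        by (simp only: x_def y_def vec_lambda_beta)
      then show "z $ i = (1 - t) * x $ i + t * y $ i" using c[of i] by simp
    qed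
    ultimately show "z \<in> ?R" by (auto simp: mem_centred_box)
  qed
  show "?R \<subseteq> ?L"
  proof clarify
    fix x y assume xy: "x \<in> centred_box a" "y \<in> centred_box b"
    show "(1 - t) *\<^sub>R x + t *\<^sub>R y \<in> ?L"
      unfolding mem_centred_box
    proof
      fix i
      have "\<bar>(1 - t) * x $ i + t * y $ i\<bar> \<le> (1 - t) * \<bar>x $ i\<bar> + t * \<bar>y $ i\<bar>"
        using t abs_triangle_ineq[of "(1 - t) * x $ i" "t * y $ i"] by (simp add: abs_mult)
      also have "\<dots> < (1 - t) * a $ i + t * b $ i"
        using xy by (intro strict) (auto simp: mem_centred_box)
      finally show "\<bar>((1 - t) *\<^sub>R x + t *\<^sub>R y) $ i\<bar> < ((1 - t) *\<^sub>R a + t *\<^sub>R b) $ i" by simp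
    qed
  qed
qed

theorem theorem10:
  fixes a b :: "real^'n::finite" and \<beta> :: real
  assumes "\<beta> \<ge> 0"
    and "\<And>i. a $ i > 0"
    and "\<And>i. b $ i > 0"
  shows "(\<forall>t\<in>{0..1}. box_path a b t =
            {(1 - t) *\<^sub>R x + t *\<^sub>R y | x y. x \<in> centred_box a \<and> y \<in> centred_box b}) \<and>
         concave_on {0..1} (\<lambda>t. robin_lambda1 \<beta> (box_path a b t) powr (- 1 / 2)) \<and>
         (\<forall>t\<in>{0..1}. 1 / sqrt (robin_lambda1 \<beta> (box_path a b t))
            \<ge> (1 - t) / sqrt (robin_lambda1 \<beta> (box_path a b 0))
              + t / sqrt (robin_lambda1 \<beta> (box_path a b 1)))"
proof -
  define c where "c t = (1 - t) *\<^sub>R a + t *\<^sub>R b" for t :: real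
  define F where "F t = robin_lambda1 \<beta> (box_path a b t) powr (- 1 / 2)" for t
  have c_pos: "c t $ i > 0" if "t \<in> {0..1}" for t i
    using that assms(2,3)[of i] unfolding c_def
    by (cases "t = 0") (auto intro!: add_nonneg_pos)
  have lambda1: "robin_lambda1 \<beta> (box_path a b t) = freq_sq_sum \<beta> (c t)" if "t \<in> {0..1}" for t
    using robin_lambda1_centred_box[OF assms(1) c_pos[OF that]] by (simp add: box_path_def c_def)
  have F: "F t = 1 / sqrt (freq_sq_sum \<beta> (c t))" if "t \<in> {0..1}" for t
    using freq_sq_sum_pos[OF assms(1) c_pos[OF that]]
    by (simp add: F_def lambda1[OF that] powr_minus_divide powr_half_sqrt)
  have concave: "concave_on {0..1} F"
    unfolding concave_on_def
  proof (rule convex_onI)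
    fix t x y :: real assume t: "0 < t" "t < 1" and xy: "x \<in> {0..1}" "y \<in> {0..1}"
    have "c ((1 - t) *\<^sub>R x + t *\<^sub>R y) = (1 - t) *\<^sub>R c x + t *\<^sub>R c y"
      by (simp add: c_def vec_eq_iff algebra_simps)
    moreover have "(1 - t) *\<^sub>R x + t *\<^sub>R y \<in> {0..1}"
      using convexD[OF convex_real_interval(5)[of 0 1] xy, of "1 - t" t] t by simp
    ultimately show "- F ((1 - t) *\<^sub>R x + t *\<^sub>R y) \<le> (1 - t) * - F x + t * - F y"
      using freq_sq_sum_concave[OF assms(1) c_pos[OF xy(1)] c_pos[OF xy(2)] t] xy by (simp add: F)
  qed simp
  then have "(1 - t) / sqrt (robin_lambda1 \<beta> (box_path a b 0))
      + t / sqrt (robin_lambda1 \<beta> (box_path a b 1)) \<le> 1 / sqrt (robin_lambda1 \<beta> (box_path a b t))"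
    if "t \<in> {0..1}" for t
    using concave_onD[OF concave, of t 0 1] that by (simp add: F lambda1)
  then show ?thesis
    using concave centred_box_Minkowski[OF assms(2,3)] by (simp add: box_path_def F_def[abs_def])
qed

end
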